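(* For every integer $d\ge 2$, $$E_{\mathrm{St}_d^\ast}(n) = (2n+1)\,E_{\mathrm{St}_{d-1}^\ast}(n) - \tfrac{1}{2}\,n(n+1)\,E_{\mathrm{St}_{d-2}^\ast}(n).$$
   Context: For $d\ge 1$, $\mathrm{St}_d^\ast = \{(x_1,\ldots,x_d)\in\mathbb{R}^d \mid -1\le x_i\le 1\ (1\le i\le d),\ x_j+\cdots+x_k\le 1\ (1\le j<k\le d)\}$ (so $\mathrm{St}_1^\ast=[-1,1]$), and by convention $E_{\mathrm{St}_0^\ast}(n)=1$. For a lattice polytope $P\subset\mathbb{R}^d$, $E_P(n)$ denotes its Ehrhart polynomial, i.e. $E_P(n)=|nP\cap\mathbb{Z}^d|$ for integers $n>0$. *)

theory Defs
  imports "Jordan_Normal_Form.Matrix" "HOL-Computational_Algebra.Polynomial"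
begin

text \<open>Points of \<open>\<real>\<^sup>d\<close> are the elements of \<^term>\<open>carrier_vec d :: real vec set\<close>; coordinates are
  indexed from 0, so the \<open>x\<^sub>i\<close> of the usual notation is \<^term>\<open>x $ (i - 1)\<close>.\<close>

definition St_star :: "nat \<Rightarrow> real vec set" where
  "St_star d = {x \<in> carrier_vec d.
     (\<forall>i<d. -1 \<le> x $ i \<and> x $ i \<le> 1) \<and>
     (\<forall>j k. j < k \<and> k < d \<longrightarrow> (\<Sum>i=j..k. x $ i) \<le> 1)}"

definition integer_points :: "nat \<Rightarrow> real vec set" where
  "integer_points d = {x \<in> carrier_vec d. \<forall>i<d. x $ i \<in> \<int>}"

definition dilate :: "nat \<Rightarrow> real vec set \<Rightarrow> real vec set" where
  "dilate n P = (\<lambda>x. real n \<cdot>\<^sub>v x) ` P"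

definition is_ehrhart_poly :: "nat \<Rightarrow> real vec set \<Rightarrow> real poly \<Rightarrow> bool" where
  "is_ehrhart_poly d P p \<longleftrightarrow>
     (\<forall>n::nat. n > 0 \<longrightarrow> poly p (real n) = real (card (dilate n P \<inter> integer_points d)))"

definition ehrhart_poly :: "nat \<Rightarrow> real vec set \<Rightarrow> real poly" where
  "ehrhart_poly d P = (THE p. is_ehrhart_poly d P p)"

lemma is_ehrhart_poly_unique:
  assumes "is_ehrhart_poly d P p" and "is_ehrhart_poly d P q"
  shows "p = q"
proof (rule ccontr)
  assume "p \<noteq> q"
  then have "finite {x. poly (p - q) x = 0}"
    by (intro poly_roots_finite) simp
  moreover have "real ` {0<..} \<subseteq> {x. poly (p - q) x = 0}"
    using assms by (auto simp: is_ehrhart_poly_def)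
  ultimately have "finite (real ` {0<..})"
    by (rule finite_subset[rotated])
  then have "finite {0::nat<..}"
    by (simp add: finite_image_iff)
  then show False
    using infinite_Ioi by blast
qed

lemma ehrhart_poly_eqI:
  assumes "is_ehrhart_poly d P p"
  shows "ehrhart_poly d P = p"
  unfolding ehrhart_poly_def
  using assms is_ehrhart_poly_unique by blast

definition E_St_star :: "nat \<Rightarrow> real poly" where
  "E_St_star d = (if d = 0 then 1 else ehrhart_poly d (St_star d))"

end

theory Submission imports Defs begin

text \<open>
  A lattice point of the \<open>n\<close>-th dilate is an integer sequence with entries at least \<open>- n\<close> all of
  whose sums over contiguous blocks are at most \<open>n\<close>. Read such a sequence from left to right and
  remember only \<open>s \<ge> 0\<close>, the largest sum of a (possibly empty) block ending at the current position:
  the next entry \<open>x\<close> is admissible iff \<open>- n \<le> x\<close> and \<open>s + x \<le> n\<close>, and the new state is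
  \<open>max 0 (s + x)\<close>. If \<open>c\<^sub>d(s)\<close> is the number of admissible continuations of length \<open>d\<close> from state \<open>s\<close>,
  then \<open>c\<^sub>d\<^sub>+\<^sub>1(s)\<close> is the sum of \<open>c\<^sub>d(max 0 y)\<close> over \<open>s - n \<le> y \<le> n\<close>. The terms lost by passing from
  state \<open>0\<close> to state \<open>s\<close> all equal \<open>c\<^sub>d(0)\<close>, so \<open>c\<^sub>d\<^sub>+\<^sub>1(s) = c\<^sub>d\<^sub>+\<^sub>1(0) - s c\<^sub>d(0)\<close>; substituting
  this into the recursion at \<open>s = 0\<close> gives the three-term recurrence.
\<close>

fun admissible :: "int \<Rightarrow> int \<Rightarrow> int list \<Rightarrow> bool" where
  "admissible n s [] \<longleftrightarrow> True"
| "admissible n s (x # xs) \<longleftrightarrow> - n \<le> x \<and> s + x \<le> n \<and> admissible n (max 0 (s + x)) xs"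

definition admissible_lists :: "int \<Rightarrow> nat \<Rightarrow> int \<Rightarrow> int list set" where
  "admissible_lists n d s = {xs. length xs = d \<and> admissible n s xs}"

lemma all_less_Suc_shift: "(\<forall>i<Suc m. P i) \<longleftrightarrow> P 0 \<and> (\<forall>i<m. P (Suc i))"
  using less_Suc_eq_0_disj by auto

lemma all_intervals_Suc_shift:
  "(\<forall>j k. j \<le> k \<and> k < Suc m \<longrightarrow> P j k) \<longleftrightarrow>
     P 0 0 \<and> (\<forall>k<m. P 0 (Suc k)) \<and> (\<forall>j k. j \<le> k \<and> k < m \<longrightarrow> P (Suc j) (Suc k))"
  (is "?L \<longleftrightarrow> ?R")
proof
  assume ?R
  show ?L
  proof (intro allI impI)
    fix j k assume "j \<le> k \<and> k < Suc m"
    with \<open>?R\<close> show "P j k" by (cases j; cases k) auto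
  qed
qed auto

lemma sum_nth_Cons_Suc:
  "(\<Sum>i=Suc j..Suc k. (x # xs) ! i) = (\<Sum>i=j..k. xs ! i)"
  "(\<Sum>i=0..Suc k. (x # xs) ! i) = x + (\<Sum>i=0..k. xs ! i)"
  for x :: "'a::comm_monoid_add"
  by (simp_all add: sum.shift_bounds_cl_Suc_ivl sum.atLeast0_atMost_Suc_shift
      del: sum.cl_ivl_Suc)

text \<open>The state \<open>s\<close> acts like the sum of a block ending just before the list, so
  it constrains only prefixes. Keeping it arbitrary lets the induction pass to the state of the
  tail; at \<open>s = 0\<close> the prefix condition is the case \<open>j = 0\<close> of the block
  condition.\<close>

lemma admissible_iff_block_sums:
  assumes "0 \<le> s"
  shows "admissible n s xs \<longleftrightarrow>
    (\<forall>i<length xs. - n \<le> xs ! i) \<and>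
    (\<forall>j k. j \<le> k \<and> k < length xs \<longrightarrow> (\<Sum>i=j..k. xs ! i) \<le> n) \<and>
    (\<forall>k<length xs. s + (\<Sum>i=0..k. xs ! i) \<le> n)"
  using assms
proof (induction xs arbitrary: s)
  case Nil
  then show ?case by simp
next
  case (Cons x xs)
  have IH: "admissible n (max 0 (s + x)) xs \<longleftrightarrow>
    (\<forall>i<length xs. - n \<le> xs ! i) \<and>
    (\<forall>j k. j \<le> k \<and> k < length xs \<longrightarrow> (\<Sum>i=j..k. xs ! i) \<le> n) \<and>
    (\<forall>k<length xs. max 0 (s + x) + (\<Sum>i=0..k. xs ! i) \<le> n)"
    by (rule Cons.IH) simp
  \<comment> \<open>The two halves of the maximum: prefixes of the tail as blocks of their own, and
    prefixes of the whole list carrying \<open>s\<close>.\<close>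
  have max_iff: "max 0 (s + x) + t \<le> n \<longleftrightarrow> t \<le> n \<and> s + (x + t) \<le> n" for t
    by linarith
  \<comment> \<open>Since \<open>s \<ge> 0\<close>, blocks starting at the head inherit their bound
    from the prefix condition.\<close>
  have drop_s: "x \<le> n" if "s + x \<le> n" for x
    using that Cons.prems by linarith
  show ?case
    unfolding admissible.simps IH length_Cons all_less_Suc_shift all_intervals_Suc_shift
      sum_nth_Cons_Suc max_iff
    using drop_s by auto
qed

lemma admissible_lists_0: "admissible_lists n 0 s = {[]}"
  by (auto simp: admissible_lists_def)

lemma admissible_lists_Suc:
  "admissible_lists n (Suc d) s =
     (\<Union>x\<in>{- n..n - s}. (#) x ` admissible_lists n d (max 0 (s + x)))"
  by (auto simp: admissible_lists_def length_Suc_conv image_iff)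

lemma finite_admissible_lists: "finite (admissible_lists n d s)"
  by (induction d arbitrary: s) (simp_all add: admissible_lists_0 admissible_lists_Suc)

text \<open>Lists with different heads are distinct, and the substitution \<open>y = s + x\<close>
  leaves \<open>s\<close> only in the range of summation, so different states can be compared term
  by term.\<close>

lemma card_admissible_lists_Suc:
  "card (admissible_lists n (Suc d) s) =
     (\<Sum>y\<in>{s - n..n}. card (admissible_lists n d (max 0 y)))"
proof -
  have "card (admissible_lists n (Suc d) s) =
      (\<Sum>x\<in>{- n..n - s}. card ((#) x ` admissible_lists n d (max 0 (s + x))))"
    unfolding admissible_lists_Suc
    by (rule card_UN_disjoint) (auto simp: finite_admissible_lists)
  also have "\<dots> = (\<Sum>x\<in>{- n..n - s}. card (admissible_lists n d (max 0 (s + x))))"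
    by (simp add: card_image)
  also have "\<dots> = (\<Sum>y\<in>{s - n..n}. card (admissible_lists n d (max 0 y)))"
    by (rule sum.reindex_bij_witness[of _ "\<lambda>y. y - s" "\<lambda>x. s + x"]) auto
  finally show ?thesis .
qed

lemma card_admissible_lists_state:
  assumes "0 \<le> s" "s \<le> n"
  shows "int (card (admissible_lists n (Suc d) s)) =
    int (card (admissible_lists n (Suc d) 0)) - s * int (card (admissible_lists n d 0))"
proof -
  let ?f = "\<lambda>y. int (card (admissible_lists n d (max 0 y)))"
  have "{- n..n} = {- n..<s - n} \<union> {s - n..n}"
    using assms by auto
  then have "sum ?f {- n..n} = sum ?f {- n..<s - n} + sum ?f {s - n..n}"
    by (simp add: sum.union_disjoint ivl_disj_int)
  \<comment> \<open>By \<open>s \<le> n\<close> every \<open>y\<close> in this range is negative, so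
    \<open>max 0 y = 0\<close>; there are \<open>s\<close> such terms.\<close>
  moreover have "sum ?f {- n..<s - n} = (\<Sum>y\<in>{- n..<s - n}. int (card (admissible_lists n d 0)))"
    using assms by (intro sum.cong) auto
  ultimately show ?thesis
    using assms by (simp add: card_admissible_lists_Suc)
qed

text \<open>The \<open>n + 1\<close> values \<open>y \<le> 0\<close> all lead to state
  \<open>0\<close>; what remains are the positive states, to which
  \<open>card_admissible_lists_state\<close> can be applied.\<close>

lemma card_admissible_lists_Suc_split:
  assumes "0 \<le> n"
  shows "int (card (admissible_lists n (Suc d) 0)) =
    (n + 1) * int (card (admissible_lists n d 0)) +
    (\<Sum>y\<in>{1..n}. int (card (admissible_lists n d y)))"
proof -
  let ?f = "\<lambda>y. int (card (admissible_lists n d (max 0 y)))"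
  have "{- n..n} = {- n..0} \<union> {1..n}"
    using assms by auto
  then have "sum ?f {- n..n} = sum ?f {- n..0} + sum ?f {1..n}"
    by (simp add: sum.union_disjoint)
  moreover have "sum ?f {- n..0} = (\<Sum>y\<in>{- n..0}. int (card (admissible_lists n d 0)))"
    by (intro sum.cong) auto
  moreover have "sum ?f {1..n} = (\<Sum>y\<in>{1..n}. int (card (admissible_lists n d y)))"
    by (intro sum.cong) auto
  ultimately show ?thesis
    using assms by (simp add: card_admissible_lists_Suc)
qed

lemma double_sum_int_atLeast1: "2 * (\<Sum>y\<in>{1..int n}. y) = int n * (int n + 1)"
proof (induction n)
  case (Suc n)
  have "{1..int (Suc n)} = insert (int (Suc n)) {1..int n}"
    by auto
  with Suc show ?case
    by (simp add: algebra_simps)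
qed simp

lemma card_admissible_lists_recurrence:
  "real (card (admissible_lists (int n) (Suc (Suc d)) 0)) =
    (2 * real n + 1) * real (card (admissible_lists (int n) (Suc d) 0))
      - 1 / 2 * real n * (real n + 1) * real (card (admissible_lists (int n) d 0))"
proof -
  define a where "a = (\<lambda>d. int (card (admissible_lists (int n) d 0)))"
  have "a (Suc (Suc d)) = (int n + 1) * a (Suc d) + (\<Sum>y\<in>{1..int n}. a (Suc d) - y * a d)"
  proof -
    have "(\<Sum>y\<in>{1..int n}. int (card (admissible_lists (int n) (Suc d) y))) =
        (\<Sum>y\<in>{1..int n}. a (Suc d) - y * a d)"
      unfolding a_def by (intro sum.cong refl card_admissible_lists_state) auto
    then show ?thesis
      by (simp add: a_def card_admissible_lists_Suc_split[of _ "Suc d"])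
  qed
  \<comment> \<open>The coefficient is \<open>(n + 1) + n\<close>: each of the \<open>n\<close>
    positive states contributes one more \<open>a (Suc d)\<close>.\<close>
  also have "\<dots> = (2 * int n + 1) * a (Suc d) - (\<Sum>y\<in>{1..int n}. y) * a d"
    by (simp add: sum_subtractf flip: sum_distrib_right) (simp add: algebra_simps)
  \<comment> \<open>Doubling avoids halving \<open>n * (n + 1)\<close> in the integers.\<close>
  finally have "2 * a (Suc (Suc d)) = 2 * (2 * int n + 1) * a (Suc d) - int n * (int n + 1) * a d"
    unfolding double_sum_int_atLeast1[symmetric] by (simp add: algebra_simps)
  from arg_cong[OF this, of real_of_int] show ?thesis
    by (simp add: a_def field_simps)
qed

lemma card_admissible_lists_1: "card (admissible_lists (int n) (Suc 0) 0) = 2 * n + 1"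
  by (simp add: card_admissible_lists_Suc admissible_lists_0)

lemma mem_dilate_St_star_iff:
  assumes "n > 0" and "x \<in> carrier_vec d"
  shows "x \<in> dilate n (St_star d) \<longleftrightarrow>
    (\<forall>i<d. - real n \<le> x $ i) \<and>
    (\<forall>j k. j \<le> k \<and> k < d \<longrightarrow> (\<Sum>i=j..k. x $ i) \<le> real n)"
proof -
  define y where "y = (1 / real n) \<cdot>\<^sub>v x"
  have y: "y \<in> carrier_vec d" "real n \<cdot>\<^sub>v y = x"
    using assms by (auto simp: y_def smult_smult_assoc)
  \<comment> \<open>Scaling by \<open>n > 0\<close> is injective, so \<open>y\<close> is the only
    candidate preimage of \<open>x\<close>.\<close>
  have "z = y" if "x = real n \<cdot>\<^sub>v z" for z
    using assms that by (simp add: y_def smult_smult_assoc)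
  with y have "x \<in> dilate n (St_star d) \<longleftrightarrow> y \<in> St_star d"
    by (auto simp: dilate_def)
  also have "\<dots> \<longleftrightarrow> (\<forall>i<d. - 1 \<le> y $ i) \<and>
      (\<forall>j k. j \<le> k \<and> k < d \<longrightarrow> (\<Sum>i=j..k. y $ i) \<le> 1)"
    (is "_ \<longleftrightarrow> ?lower \<and> ?sums")
  proof -
    \<comment> \<open>The upper bounds on single coordinates are the blocks with
      \<open>j = k\<close>.\<close>
    have "?sums \<longleftrightarrow> (\<forall>i<d. y $ i \<le> 1) \<and> (\<forall>j k. j < k \<and> k < d \<longrightarrow> (\<Sum>i=j..k. y $ i) \<le> 1)"
    proof
      assume sums: ?sums
      have "y $ i \<le> 1" if "i < d" for i
        using sums[rule_format, of i i] that by simp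
      with sums show "(\<forall>i<d. y $ i \<le> 1) \<and> (\<forall>j k. j < k \<and> k < d \<longrightarrow> (\<Sum>i=j..k. y $ i) \<le> 1)"
        by simp
    qed (auto simp: le_less)
    then show ?thesis
      using y by (auto simp: St_star_def)
  qed
  also have "?lower \<longleftrightarrow> (\<forall>i<d. - real n \<le> x $ i)"
    using assms by (auto simp: y_def field_simps)
  also have "?sums \<longleftrightarrow> (\<forall>j k. j \<le> k \<and> k < d \<longrightarrow> (\<Sum>i=j..k. x $ i) \<le> real n)"
  proof -
    have "(\<Sum>i=j..k. y $ i) = (\<Sum>i=j..k. x $ i) / real n" if "k < d" for j k
      using assms that by (simp add: y_def sum_divide_distrib)
    then have "(\<Sum>i=j..k. y $ i) \<le> 1 \<longleftrightarrow> (\<Sum>i=j..k. x $ i) \<le> real n" if "k < d" for j k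
      using assms that by simp
    then show ?thesis by blast
  qed
  finally show ?thesis .
qed

lemma card_dilate_St_star:
  assumes "n > 0"
  shows "card (dilate n (St_star d) \<inter> integer_points d) = card (admissible_lists (int n) d 0)"
proof -
  define g where "g = (\<lambda>xs. vec_of_list (map real_of_int xs))"
  have g_carrier: "g xs \<in> carrier_vec d" if "length xs = d" for xs
    using that by (auto simp: g_def intro!: carrier_vecI)
  have g_nth: "g xs $ i = real_of_int (xs ! i)" if "i < length xs" for xs i
    using that by (simp add: g_def vec_of_list_index)
  have g_mem: "g xs \<in> dilate n (St_star d) \<longleftrightarrow> xs \<in> admissible_lists (int n) d 0"
    if len: "length xs = d" for xs
  proof -
    have sum_eq: "(\<Sum>i=j..k. g xs $ i) = real_of_int (\<Sum>i=j..k. xs ! i)" if "k < d" for j k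
      using that len by (simp add: g_nth)
    have lower: "(\<forall>i<d. - real n \<le> g xs $ i) \<longleftrightarrow> (\<forall>i<d. - int n \<le> xs ! i)"
    proof -
      have "- real n \<le> g xs $ i \<longleftrightarrow> - int n \<le> xs ! i" if "i < d" for i
        using that len by (simp add: g_nth) linarith
      then show ?thesis by blast
    qed
    have sums: "(\<forall>j k. j \<le> k \<and> k < d \<longrightarrow> (\<Sum>i=j..k. g xs $ i) \<le> real n) \<longleftrightarrow>
        (\<forall>j k. j \<le> k \<and> k < d \<longrightarrow> (\<Sum>i=j..k. xs ! i) \<le> int n)"
    proof -
      have "(\<Sum>i=j..k. g xs $ i) \<le> real n \<longleftrightarrow> (\<Sum>i=j..k. xs ! i) \<le> int n" if "k < d" for j k
        unfolding sum_eq[OF that] by linarith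
      then show ?thesis by blast
    qed
    show ?thesis
      unfolding mem_dilate_St_star_iff[OF assms g_carrier[OF len]] lower sums
      using len by (auto simp: admissible_lists_def admissible_iff_block_sums)
  qed
  have "dilate n (St_star d) \<inter> integer_points d = g ` admissible_lists (int n) d 0"
  proof (intro equalityI subsetI)
    fix x assume x: "x \<in> dilate n (St_star d) \<inter> integer_points d"
    \<comment> \<open>On integer coordinates the floor is exact, so \<open>xs\<close> is the
      preimage of \<open>x\<close> under \<open>g\<close>.\<close>
    define xs where "xs = map (\<lambda>i. \<lfloor>x $ i\<rfloor>) [0..<d]"
    have "g xs = x"
      using x by (intro eq_vecI) (auto simp: g_def xs_def integer_points_def vec_of_list_index)
    then show "x \<in> g ` admissible_lists (int n) d 0"
      using x g_mem[of xs] by (intro image_eqI[of _ _ xs]) (simp_all add: xs_def)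
  next
    fix x assume "x \<in> g ` admissible_lists (int n) d 0"
    then obtain xs where xs: "x = g xs" "xs \<in> admissible_lists (int n) d 0" by blast
    then have "length xs = d" by (simp add: admissible_lists_def)
    with xs show "x \<in> dilate n (St_star d) \<inter> integer_points d"
      using g_mem g_carrier by (auto simp: integer_points_def g_nth)
  qed
  moreover have "inj g"
  proof (rule injI)
    fix xs ys assume "g xs = g ys"
    then have "list_of_vec (g xs) = list_of_vec (g ys)" by simp
    then show "xs = ys"
      unfolding g_def list_vec by (simp add: inj_map_eq_map inj_def)
  qed
  ultimately show ?thesis
    by (simp add: card_image inj_on_subset)
qed

text \<open>Taking the recurrence as the definition yields the existence of the Ehrhart polynomials,
  which the definite description in \<open>ehrhart_poly\<close> requires. The coefficients encode
  \<open>2 * n + 1\<close> and \<open>n * (n + 1) / 2\<close>.\<close>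

fun St_star_poly :: "nat \<Rightarrow> real poly" where
  "St_star_poly 0 = 1"
| "St_star_poly (Suc 0) = [:1, 2:]"
| "St_star_poly (Suc (Suc d)) =
     [:1, 2:] * St_star_poly (Suc d) - [:0, 1 / 2, 1 / 2:] * St_star_poly d"

lemma poly_St_star_poly:
  "poly (St_star_poly d) (real n) = real (card (admissible_lists (int n) d 0))"
proof (induction d rule: St_star_poly.induct)
  case 1
  then show ?case by (simp add: admissible_lists_0)
next
  case 2
  then show ?case by (simp add: card_admissible_lists_1)
next
  case (3 d)
  then show ?case
    by (simp add: card_admissible_lists_recurrence algebra_simps)
qed

lemma E_St_star_eq: "E_St_star d = St_star_poly d"
proof (cases "d = 0")
  case False
  have "is_ehrhart_poly d (St_star d) (St_star_poly d)"
    by (simp add: is_ehrhart_poly_def poly_St_star_poly card_dilate_St_star)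
  with False show ?thesis
    by (simp add: E_St_star_def ehrhart_poly_eqI)
qed (simp add: E_St_star_def)

text \<open>By \<open>E_St_star_eq\<close> this is the defining equation of
  \<open>St_star_poly\<close>, an identity of polynomials, hence valid at every real
  \<open>n\<close>.\<close>

theorem theorem3p1:
  fixes d :: nat and n :: real
  assumes "d \<ge> 2"
  shows "poly (E_St_star d) n =
    (2 * n + 1) * poly (E_St_star (d - 1)) n
      - 1 / 2 * n * (n + 1) * poly (E_St_star (d - 2)) n"
proof -
  from assms obtain m where "d = Suc (Suc m)"
    by (metis Suc_le_D numeral_2_eq_2 Suc_le_mono)
  then show ?thesis
    by (simp add: E_St_star_eq algebra_simps)
qed

end
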